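(* Let $A$ (choice variables) and $X$ (chance variables) be disjoint finite sets of propositional variables, let $R\subseteq X$ be a set of relaxed variables, and let $f$ be a formula in $(A\uplus R,X\setminus R)$-layered smooth decision-DNNF. Let $U(f)$ be the upper bound computed by the algorithm Relax with set of relaxed variables $R$, and $N(f)$ the upper bound computed by the algorithm Unconstrained. If $R=X$, then $U(f)=N(f)$.
   Context: Decision-DNNF. A formula in decision-DNNF is a DAG built from the following nodes ($V(f)$ denotes the set of variables of $f$): (i) $\top$ and $\bot$, with $V(\top)=V(\bot)=\varnothing$; (ii) decomposable And nodes $\bigwedge_{i=1}^n f_i$ where the $f_i$ are in decision-DNNF and $V(f_i)\cap V(f_j)=\varnothing$ for $i\ne j$; (iii) decision nodes $\mathrm{ite}(v,g,h)$ ("if $v$ then $g$ else $h$") where $v$ is a variable, $g,h$ are in decision-DNNF, $v\notin V(g)$ and $v\notin V(h)$; $V(\mathrm{ite}(v,g,h))=\{v\}\cup V(g)\cup V(h)$. The formula is smooth if $V(g)=V(h)$ for every decision node $\mathrm{ite}(v,g,h)$. For disjoint sets $Y,Z$ of variables, it is $(Y,Z)$-layered if $V(f)\subseteq Y\uplus Z$ and, for every decision node $\mathrm{ite}(v,g,h)$, $v\in Z$ implies $V(g)\subseteq Z$. Upper bound $U$ of Relax: $U(\top)=1$, $U(\bot)=0$; $U(\mathrm{ite}(v,g,h))=U(g)+U(h)$ if $v\in X\setminus R$; $U(\mathrm{ite}(v,g,h))=\max(U(g),U(h))$ if $v\in A$; $U(\mathrm{ite}(v,g,h))=U(g)+U(h)$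 if $v\in R$; $U(\bigwedge_{i=1}^n g_i)=\prod_{i=1}^n U(g_i)$. Upper bound $N$ of Unconstrained (defined on any decision-DNNF formula): $N(\top)=1$, $N(\bot)=0$; $N(\mathrm{ite}(v,g,h))=N(g)+N(h)$ if $v\notin A$; $N(\mathrm{ite}(v,g,h))=\max(N(g),N(h))$ if $v\in A$; $N(\bigwedge_{i=1}^n g_i)=\prod_{i=1}^n N(g_i)$. *)

theory Defs
  imports Main
begin

text \<open>A formula is a rooted DAG: every node identifier of type \<open>'n\<close> is labelled with its kind and with
  the identifiers of its children, so that nodes can be shared. The children of a conjunction form
  a list because the same node may occur at several positions \<open>i\<close>.\<close>

datatype (decision_vars: 'v, children: 'n) node =
    Top
  | Bot
  | And "'n list"
  | Ite 'v 'n 'n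
  for map: map_node

record ('v, 'n) formula =
  label :: "'n \<Rightarrow> ('v, 'n) node"
  root :: 'n

text \<open>The function \<open>label\<close> is total; only the identifiers reachable from the root belong to the formula.\<close>

definition nodes :: "('v, 'n) formula \<Rightarrow> 'n set" where
  "nodes f = {n. (root f, n) \<in> {(m, c). c \<in> children (label f m)}\<^sup>*}"

definition child_rel :: "('v, 'n) formula \<Rightarrow> ('n \<times> 'n) set" where
  "child_rel f = {(c, n). n \<in> nodes f \<and> c \<in> children (label f n)}"

definition is_dag :: "('v, 'n) formula \<Rightarrow> bool" where
  "is_dag f \<longleftrightarrow> finite (nodes f) \<and> acyclic (child_rel f)"

text \<open>Bottom-up evaluation at a node: \<open>step\<close> receives the label of the node with each child replaced
  by the value computed for it. For DAGs the recursion equation is \<open>eval_node_unfold\<close> below.\<close>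

definition eval_node :: "(('v, 'b) node \<Rightarrow> 'b) \<Rightarrow> ('v, 'n) formula \<Rightarrow> 'n \<Rightarrow> 'b" where
  "eval_node step f = wfrec (child_rel f) (\<lambda>rec n. step (map_node id rec (label f n)))"

lemma eval_node_unfold:
  assumes "is_dag f" and "n \<in> nodes f"
  shows "eval_node step f n = step (map_node id (eval_node step f) (label f n))"
proof -
  have fin: "finite (child_rel f)"
  proof (rule finite_subset)
    show "child_rel f \<subseteq> nodes f \<times> nodes f"
      unfolding child_rel_def nodes_def by (auto intro: rtrancl.rtrancl_into_rtrancl)
    show "finite (nodes f \<times> nodes f)"
      using assms(1) by (simp add: is_dag_def)
  qed
  have wf: "wf (child_rel f)"
    using fin assms(1) by (simp add: is_dag_def finite_acyclic_wf)
  have "map_node id (cut (eval_node step f) (child_rel f) n) (label f n)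
      = map_node id (eval_node step f) (label f n)"
    by (rule node.map_cong0) (use assms(2) in \<open>auto simp: cut_def child_rel_def\<close>)
  then show ?thesis
    using wfrec[OF wf, of "\<lambda>rec n. step (map_node id rec (label f n))" n]
    by (simp add: eval_node_def)
qed

fun vars_step :: "('v, 'v set) node \<Rightarrow> 'v set" where
  "vars_step Top = {}"
| "vars_step Bot = {}"
| "vars_step (And Vs) = \<Union>(set Vs)"
| "vars_step (Ite v V W) = {v} \<union> V \<union> W"

definition vars_at :: "('v, 'n) formula \<Rightarrow> 'n \<Rightarrow> 'v set" where
  "vars_at = eval_node vars_step"

definition vars :: "('v, 'n) formula \<Rightarrow> 'v set" where
  "vars f = vars_at f (root f)"

definition decision_dnnf :: "('v, 'n) formula \<Rightarrow> bool" where
  "decision_dnnf f \<longleftrightarrow>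
     is_dag f \<and>
     (\<forall>n \<in> nodes f. \<forall>gs. label f n = And gs \<longrightarrow>
        (\<forall>i < length gs. \<forall>j < length gs. i \<noteq> j \<longrightarrow> vars_at f (gs ! i) \<inter> vars_at f (gs ! j) = {})) \<and>
     (\<forall>n \<in> nodes f. \<forall>v g h. label f n = Ite v g h \<longrightarrow>
        v \<notin> vars_at f g \<and> v \<notin> vars_at f h)"

definition smooth :: "('v, 'n) formula \<Rightarrow> bool" where
  "smooth f \<longleftrightarrow>
     (\<forall>n \<in> nodes f. \<forall>v g h. label f n = Ite v g h \<longrightarrow> vars_at f g = vars_at f h)"

definition layered :: "'v set \<Rightarrow> 'v set \<Rightarrow> ('v, 'n) formula \<Rightarrow> bool" where
  "layered Y Z f \<longleftrightarrow>
     vars f \<subseteq> Y \<union> Z \<and>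
     (\<forall>n \<in> nodes f. \<forall>v g h. label f n = Ite v g h \<longrightarrow> v \<in> Z \<longrightarrow> vars_at f g \<subseteq> Z)"

text \<open>The bound of Relax is left unspecified on decision variables outside \<open>A \<union> X\<close>.\<close>

fun relax_step :: "'v set \<Rightarrow> 'v set \<Rightarrow> 'v set \<Rightarrow> ('v, nat) node \<Rightarrow> nat" where
  "relax_step A X R Top = 1"
| "relax_step A X R Bot = 0"
| "relax_step A X R (Ite v p q) =
     (if v \<in> X - R then p + q
      else if v \<in> A then max p q
      else if v \<in> R then p + q
      else undefined)"
| "relax_step A X R (And ps) = prod_list ps"

definition relax_bound :: "'v set \<Rightarrow> 'v set \<Rightarrow> 'v set \<Rightarrow> ('v, 'n) formula \<Rightarrow> nat" where
  "relax_bound A X R f = eval_node (relax_step A X R) f (root f)"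

fun unconstrained_step :: "'v set \<Rightarrow> ('v, nat) node \<Rightarrow> nat" where
  "unconstrained_step A Top = 1"
| "unconstrained_step A Bot = 0"
| "unconstrained_step A (Ite v p q) = (if v \<notin> A then p + q else max p q)"
| "unconstrained_step A (And ps) = prod_list ps"

definition unconstrained_bound :: "'v set \<Rightarrow> ('v, 'n) formula \<Rightarrow> nat" where
  "unconstrained_bound A f = eval_node (unconstrained_step A) f (root f)"

end

theory Submission
  imports Defs
begin

text \<open>With \<open>R = X\<close> the set \<open>X - R\<close> is empty, so on every decision
  variable in \<open>A \<union> X\<close> both algorithms apply the same rule: maximum on
  \<open>A\<close>, sum elsewhere. Layeredness confines the variables of the formula to
  \<open>A \<union> X\<close>, so the two bottom-up evaluations agree at every node;
  \<open>eval_node_cong_vars\<close> carries this from single labels to the whole DAG.\<close>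

lemma child_in_nodes:
  assumes "n \<in> nodes f" and "c \<in> children (label f n)"
  shows "c \<in> nodes f"
  using assms unfolding nodes_def by (auto intro: rtrancl.rtrancl_into_rtrancl)

lemma root_in_nodes: "root f \<in> nodes f"
  by (simp add: nodes_def)

lemma wf_child_rel:
  assumes "is_dag f"
  shows "wf (child_rel f)"
proof (rule finite_acyclic_wf)
  have "child_rel f \<subseteq> nodes f \<times> nodes f"
    by (auto simp: child_rel_def intro: child_in_nodes)
  then show "finite (child_rel f)"
    using assms by (auto simp: is_dag_def intro: finite_subset)
  show "acyclic (child_rel f)"
    using assms by (simp add: is_dag_def)
qed

text \<open>A finite acyclic child relation is well-founded, and children of nodes are again
  nodes.\<close>

lemma dag_induct [consumes 2, case_names node]:
  assumes "is_dag f" and "n \<in> nodes f"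
    and "\<And>n. n \<in> nodes f \<Longrightarrow> (\<And>c. c \<in> children (label f n) \<Longrightarrow> P c) \<Longrightarrow> P n"
  shows "P n"
  using wf_child_rel[OF assms(1)] assms(2)
proof (induction n rule: wf_induct_rule)
  case (less n)
  then show ?case
    by (auto intro: assms(3) child_in_nodes simp: child_rel_def)
qed

text \<open>This uniform form of \<open>vars_step\<close> lets a bound on the variables pass from a
  node to its own label and to its children.\<close>

lemma vars_at_unfold:
  assumes "is_dag f" and "n \<in> nodes f"
  shows "vars_at f n =
    decision_vars (label f n) \<union> (\<Union>c \<in> children (label f n). vars_at f c)"
  unfolding vars_at_def eval_node_unfold[OF assms]
  by (cases "label f n") auto

text \<open>Evaluation below \<open>n\<close> only meets labels whose decision variable lies in
  \<open>vars_at f n\<close>, so the behaviour of \<open>s\<close> and \<open>t\<close> on other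
  labels is irrelevant.\<close>

lemma eval_node_cong_vars:
  assumes "is_dag f" and "n \<in> nodes f" and "vars_at f n \<subseteq> V"
    and step: "\<And>l. decision_vars l \<subseteq> V \<Longrightarrow> s l = t l"
  shows "eval_node s f n = eval_node t f n"
  using assms(1-3)
proof (induction n rule: dag_induct)
  case (node n)
  have vars: "decision_vars (label f n) \<subseteq> V"
    "\<And>c. c \<in> children (label f n) \<Longrightarrow> vars_at f c \<subseteq> V"
    using node.prems vars_at_unfold[OF assms(1) node.hyps] by auto
  have "map_node id (eval_node s f) (label f n) = map_node id (eval_node t f) (label f n)"
    by (rule node.map_cong0) (simp_all add: node.IH vars(2))
  \<comment> \<open>Replacing children by their values keeps the decision variable, so
    \<open>step\<close> applies to the label actually evaluated.\<close>
  moreover have "decision_vars (map_node id (eval_node t f) (label f n)) \<subseteq> V"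
    using vars(1) by (simp add: node.set_map)
  ultimately show ?case
    by (simp add: eval_node_unfold[OF assms(1) node.hyps] step)
qed

theorem proposition7p12:
  fixes A X R :: "'v set" and f :: "('v, 'n) formula"
  assumes "finite A" and "finite X" and "A \<inter> X = {}" and "R \<subseteq> X"
    and "decision_dnnf f" and "smooth f" and "layered (A \<union> R) (X - R) f"
    and "R = X"
  shows "relax_bound A X R f = unconstrained_bound A f"
  unfolding relax_bound_def unconstrained_bound_def
proof (rule eval_node_cong_vars)
  show "is_dag f"
    using assms(5) by (simp add: decision_dnnf_def)
  show "vars_at f (root f) \<subseteq> A \<union> X"
    using assms(7,8) by (simp add: layered_def vars_def)
  \<comment> \<open>The bound \<open>A \<union> X\<close> rules out the \<open>undefined\<close>
    branch of \<open>relax_step\<close>.\<close>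
  show "relax_step A X R l = unconstrained_step A l" if "decision_vars l \<subseteq> A \<union> X" for l
    using that assms(8) by (cases l) auto
qed (rule root_in_nodes)

end
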